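(* Let $R$ be a semiprime (associative, unital) ring and let $a,b\in Reg(R)$. Then $I(a)=I(b)$ if and only if $a=b$.
   Context: For an associative ring $R$ with unity and $a\in R$: an inner inverse of $a$ is an $x\in R$ with $axa=a$; $I(a)$ denotes the set of inner inverses of $a$; $a$ is (von Neumann) regular if $I(a)\neq\emptyset$, and $Reg(R)$ is the set of regular elements of $R$. The ring $R$ is semiprime if, for $c\in R$, $cRc=0$ implies $c=0$. *)

theory Defs
  imports "HOL-Algebra.Ring"
begin

definition inner_inverses :: "('a, 'b) ring_scheme \<Rightarrow> 'a \<Rightarrow> 'a set" where
  "inner_inverses R a = {x \<in> carrier R. a \<otimes>\<^bsub>R\<^esub> x \<otimes>\<^bsub>R\<^esub> a = a}"

definition regular_elements :: "('a, 'b) ring_scheme \<Rightarrow> 'a set" where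
  "regular_elements R = {a \<in> carrier R. inner_inverses R a \<noteq> {}}"

locale semiprime_ring = ring R for R (structure) +
  assumes semiprime:
    "\<lbrakk>c \<in> carrier R; \<And>r. r \<in> carrier R \<Longrightarrow> c \<otimes> r \<otimes> c = \<zero>\<rbrakk> \<Longrightarrow> c = \<zero>"

end

theory Submission
  imports Defs
begin

text \<open>
  If \<open>x\<close> is an inner inverse of \<open>a\<close>, then so is \<open>x + u\<close> for every \<open>u\<close> with \<open>a u a = 0\<close>, in
  particular for every \<open>u\<close> in the right ideal \<open>(1 - x a) R\<close> or in the left ideal \<open>R (1 - a x)\<close>.
  When \<open>I(a) \<subseteq> I(b)\<close>, all these perturbations are inner inverses of \<open>b\<close> as well, so
  \<open>b u b = 0\<close>. The element \<open>c = b (1 - x a)\<close> thus satisfies \<open>c R b = 0\<close>, hence \<open>c R c = 0\<close>,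
  and semiprimeness gives \<open>c = 0\<close>, that is, \<open>b = b x a\<close>. The mirror-image argument gives
  \<open>b = a x b\<close>. Now let \<open>I(a) = I(b)\<close> and take a common inner inverse \<open>x\<close>: the inclusion
  \<open>I(a) \<subseteq> I(b)\<close> gives \<open>b = a x b\<close>, and the opposite inclusion, with the roles of \<open>a\<close> and \<open>b\<close>
  exchanged in the other identity, gives \<open>a = a x b\<close>. So \<open>a = b\<close>.
\<close>

context ring
begin

lemma add_in_inner_inverses:
  assumes "a \<in> carrier R" and "x \<in> inner_inverses R a"
    and "u \<in> carrier R" and "a \<otimes> u \<otimes> a = \<zero>"
  shows "x \<oplus> u \<in> inner_inverses R a"
  using assms by (simp add: inner_inverses_def l_distr r_distr)

lemma mult_eq_zero_if_add_in_inner_inverses: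
  assumes "b \<in> carrier R" and "x \<in> inner_inverses R b"
    and "u \<in> carrier R" and "x \<oplus> u \<in> inner_inverses R b"
  shows "b \<otimes> u \<otimes> b = \<zero>"
proof -
  have "x \<in> carrier R" and "b \<otimes> x \<otimes> b = b" and "b \<otimes> (x \<oplus> u) \<otimes> b = b"
    using assms(2,4) by (auto simp: inner_inverses_def)
  then have "b \<oplus> b \<otimes> u \<otimes> b = b"
    using assms(1,3) by (simp add: l_distr r_distr)
  then show ?thesis
    using assms(1,3) by (simp add: add.l_cancel_one)
qed

text \<open>
  Adding \<open>u\<close> to one fixed inner inverse turns the inclusion of the sets of inner inverses into an
  implication between the homogeneous equations \<open>a u a = 0\<close> and \<open>b u b = 0\<close>.
\<close>

lemma inner_inverses_subset_annihilated:
  assumes "a \<in> carrier R" and "b \<in> carrier R"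
    and "inner_inverses R a \<subseteq> inner_inverses R b" and "x \<in> inner_inverses R a"
    and "u \<in> carrier R" and "a \<otimes> u \<otimes> a = \<zero>"
  shows "b \<otimes> u \<otimes> b = \<zero>"
proof (rule mult_eq_zero_if_add_in_inner_inverses[OF assms(2) _ assms(5)])
  show "x \<in> inner_inverses R b"
    by (rule subsetD[OF assms(3,4)])
  show "x \<oplus> u \<in> inner_inverses R b"
    by (rule subsetD[OF assms(3) add_in_inner_inverses[OF assms(1,4,5,6)]])
qed

end

context semiprime_ring
begin

text \<open>
  The right ideal \<open>(1 - x a) R\<close> is killed by left multiplication with \<open>a\<close>; semiprimeness
  upgrades \<open>b (1 - x a) R b = 0\<close> to \<open>b (1 - x a) = 0\<close>.
\<close>

lemma inner_inverses_subset_imp_eq_mult_right: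
  assumes a: "a \<in> carrier R" and b: "b \<in> carrier R"
    and sub: "inner_inverses R a \<subseteq> inner_inverses R b" and xI: "x \<in> inner_inverses R a"
  shows "b = b \<otimes> x \<otimes> a"
proof -
  have x: "x \<in> carrier R" and axa: "a \<otimes> x \<otimes> a = a"
    using xI by (auto simp: inner_inverses_def)
  define e where "e = \<one> \<ominus> x \<otimes> a"
  have e: "e \<in> carrier R"
    using a x by (simp add: e_def)
  have ae: "a \<otimes> e = \<zero>"
    using a x axa by (simp add: e_def a_minus_def r_distr r_minus r_neg flip: m_assoc)
  have "b \<otimes> e = \<zero>"
  proof (rule semiprime)
    fix r assume r: "r \<in> carrier R"
    have "a \<otimes> (e \<otimes> r) \<otimes> a = \<zero>"
      using a e r ae by (simp flip: m_assoc)
    then have "b \<otimes> (e \<otimes> r) \<otimes> b = \<zero>"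
      using inner_inverses_subset_annihilated[OF a b sub xI] e r by simp
    then have "b \<otimes> (e \<otimes> r) \<otimes> b \<otimes> e = \<zero>"
      using e by simp
    then show "b \<otimes> e \<otimes> r \<otimes> (b \<otimes> e) = \<zero>"
      using b e r by (simp add: m_assoc)
  qed (use b e in simp)
  moreover have "x \<otimes> a \<oplus> e = \<one>"
    using a x by (simp add: e_def a_minus_def a_lcomm r_neg)
  then have "b \<otimes> (x \<otimes> a \<oplus> e) = b"
    using b by simp
  ultimately show ?thesis
    using a b x e by (simp add: r_distr m_assoc)
qed

lemma inner_inverses_subset_imp_eq_mult_left:
  assumes a: "a \<in> carrier R" and b: "b \<in> carrier R"
    and sub: "inner_inverses R a \<subseteq> inner_inverses R b" and xI: "x \<in> inner_inverses R a"
  shows "b = a \<otimes> x \<otimes> b"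
proof -
  have x: "x \<in> carrier R" and axa: "a \<otimes> x \<otimes> a = a"
    using xI by (auto simp: inner_inverses_def)
  define e where "e = \<one> \<ominus> a \<otimes> x"
  have e: "e \<in> carrier R"
    using a x by (simp add: e_def)
  have ea: "e \<otimes> a = \<zero>"
    using a x axa by (simp add: e_def a_minus_def l_distr l_minus r_neg)
  have "e \<otimes> b = \<zero>"
  proof (rule semiprime)
    fix r assume r: "r \<in> carrier R"
    have "a \<otimes> (r \<otimes> e) \<otimes> a = \<zero>"
      using a e r ea by (simp add: m_assoc)
    then have "b \<otimes> (r \<otimes> e) \<otimes> b = \<zero>"
      using inner_inverses_subset_annihilated[OF a b sub xI] e r by simp
    then have "e \<otimes> (b \<otimes> (r \<otimes> e) \<otimes> b) = \<zero>"
      using e by simp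
    then show "e \<otimes> b \<otimes> r \<otimes> (e \<otimes> b) = \<zero>"
      using b e r by (simp add: m_assoc)
  qed (use b e in simp)
  moreover have "a \<otimes> x \<oplus> e = \<one>"
    using a x by (simp add: e_def a_minus_def a_lcomm r_neg)
  then have "(a \<otimes> x \<oplus> e) \<otimes> b = b"
    using b by simp
  ultimately show ?thesis
    using a b x e by (simp add: l_distr)
qed

end

theorem theorem7:
  fixes R :: "('a, 'b) ring_scheme" and a b :: 'a
  assumes "semiprime_ring R"
    and "a \<in> regular_elements R" and "b \<in> regular_elements R"
  shows "inner_inverses R a = inner_inverses R b \<longleftrightarrow> a = b"
proof
  interpret semiprime_ring R by fact
  assume eq: "inner_inverses R a = inner_inverses R b"
  have a: "a \<in> carrier R" and b: "b \<in> carrier R"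
    using assms(2,3) by (auto simp: regular_elements_def)
  obtain x where xa: "x \<in> inner_inverses R a"
    using assms(2) by (auto simp: regular_elements_def)
  then have xb: "x \<in> inner_inverses R b"
    using eq by simp
  have "a = a \<otimes>\<^bsub>R\<^esub> x \<otimes>\<^bsub>R\<^esub> b"
    by (rule inner_inverses_subset_imp_eq_mult_right[OF b a eq[symmetric, THEN equalityD1] xb])
  also have "\<dots> = b"
    by (rule inner_inverses_subset_imp_eq_mult_left[OF a b eq[THEN equalityD1] xa, symmetric])
  finally show "a = b" .
qed simp

end
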